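(* Let $\Omega$ be finite and consider a sequence of probability spaces $(\Omega^{V_n},\mu_n)$ with $V_n$ finite. There is random sparse reconstruction for this sequence if and only if there is a sequence of Boolean functions $f_n:\Omega^{V_n}\to\{-1,1\}$ such that there is full random sparse reconstruction for $\{f_n\}$.
   Context: Clue: for $f:\Omega^V\to\mathbb R$ and $U\subseteq V$, $\mathsf{clue}(f\,|\,U):=\mathrm{Var}(\mathbb E[f\,|\,\mathcal F_U])/\mathrm{Var}(f)$, where $\mathcal F_U$ is generated by the coordinates in $U$ (clue $=0$ if $\mathrm{Var}(f)=0$). Here, random sparse reconstruction for the sequence means: there exist functions $f_n:\Omega^{V_n}\to\mathbb R$, random subsets $\mathcal U_n\subseteq V_n$ independent of the spin system with $\max_{j\in V_n}\mathbb P[j\in\mathcal U_n]\to0$, and $c>0$ such that $\mathbb E[\mathsf{clue}(f_n\,|\,\mathcal U_n)]>c$ for all $n$. Full random sparse reconstruction for a given sequence $\{f_n\}$ means that there are such random subsets $\mathcal U_n$ (independent of the spins, with $\max_j\mathbb P[j\in\mathcal U_n]\to0$) with $\lim_n\mathbb E[\mathsf{clue}(f_n\,|\,\mathcal U_n)]=1$.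
   Formalization: It is additionally assumed that no μ_n is a point mass; otherwise "for all n" in random sparse reconstruction fails at a single degenerate n although full reconstruction, which is asymptotic, can still hold. *)

theory Defs
  imports "HOL-Probability.Probability"
begin

text \<open>A probability measure on the configuration space, the functions from \<open>V\<close> to \<open>\<Omega>\<close>
  (extensional, i.e. \<open>undefined\<close> outside \<open>V\<close>). All subsets are measurable, since \<open>V\<close> and \<open>\<Omega>\<close> are
  finite.\<close>

locale spin_system = prob_space M
  for \<Omega> :: "'a set" and V :: "'v set" and M :: "('v \<Rightarrow> 'a) measure" +
  assumes finite_spins: "finite \<Omega>"
    and finite_sites: "finite V"
    and sets_eq: "sets M = sets (\<Pi>\<^sub>M j\<in>V. count_space \<Omega>)"
begin

definition coord_algebra :: "'v set \<Rightarrow> ('v \<Rightarrow> 'a) measure" where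
  "coord_algebra U = sigma (space M) {{\<omega> \<in> space M. \<omega> j = a} | j a. j \<in> U \<and> a \<in> \<Omega>}"

text \<open>Division by zero is zero in HOL, so \<open>clue f U = 0\<close> if \<open>variance f = 0\<close>.\<close>

definition clue :: "(('v \<Rightarrow> 'a) \<Rightarrow> real) \<Rightarrow> 'v set \<Rightarrow> real" where
  "clue f U = variance (real_cond_exp M (coord_algebra U) f) / variance f"

text \<open>The expected clue about \<open>f\<close> of a random set with law \<open>\<nu>\<close> that is independent of the spins.
  Independence means that the joint law of the configuration and the set is the product of \<open>M\<close>
  and \<open>\<nu>\<close>. As the clue is a function of the value of the set alone, its expectation is the integral
  with respect to \<open>\<nu>\<close>.\<close>

definition expected_clue :: "(('v \<Rightarrow> 'a) \<Rightarrow> real) \<Rightarrow> 'v set pmf \<Rightarrow> real" where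
  "expected_clue f \<nu> = measure_pmf.expectation \<nu> (clue f)"

end

text \<open>Random subsets are represented by their laws.\<close>

definition sparse_random_subsets :: "(nat \<Rightarrow> 'v set) \<Rightarrow> (nat \<Rightarrow> 'v set pmf) \<Rightarrow> bool" where
  "sparse_random_subsets V \<nu> \<longleftrightarrow>
     (\<forall>n. set_pmf (\<nu> n) \<subseteq> Pow (V n)) \<and>
     (\<lambda>n. MAX j\<in>V n. measure_pmf.prob (\<nu> n) {U. j \<in> U}) \<longlonglongrightarrow> 0"

definition random_sparse_reconstruction ::
    "'a set \<Rightarrow> (nat \<Rightarrow> 'v set) \<Rightarrow> (nat \<Rightarrow> ('v \<Rightarrow> 'a) measure) \<Rightarrow> bool" where
  "random_sparse_reconstruction \<Omega> V \<mu> \<longleftrightarrow>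
     (\<exists>(f :: nat \<Rightarrow> ('v \<Rightarrow> 'a) \<Rightarrow> real) \<nu> c. sparse_random_subsets V \<nu> \<and> c > 0 \<and>
        (\<forall>n. spin_system.expected_clue \<Omega> (\<mu> n) (f n) (\<nu> n) > c))"

definition full_random_sparse_reconstruction ::
    "'a set \<Rightarrow> (nat \<Rightarrow> 'v set) \<Rightarrow> (nat \<Rightarrow> ('v \<Rightarrow> 'a) measure) \<Rightarrow> (nat \<Rightarrow> ('v \<Rightarrow> 'a) \<Rightarrow> real) \<Rightarrow> bool" where
  "full_random_sparse_reconstruction \<Omega> V \<mu> f \<longleftrightarrow>
     (\<exists>\<nu>. sparse_random_subsets V \<nu> \<and>
        (\<lambda>n. spin_system.expected_clue \<Omega> (\<mu> n) (f n) (\<nu> n)) \<longlonglongrightarrow> 1)"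

end

theory Submission
  imports Defs
begin

text \<open>Let \<open>\<U>\<close> be the random set, \<open>m\<close> the mean of \<open>f\<close> and \<open>h\<close> the average of
  \<open>E[f | F\<^sub>U] - m\<close> over \<open>U\<close>. Since \<open>E[h (f - m)] = E[clue(f | \<U>)] Var f\<close>, Cauchy--Schwarz bounds
  \<open>Var h\<close> from below. For \<open>k\<close> independent copies \<open>U\<^sub>1, \<dots>, U\<^sub>k\<close> of \<open>\<U>\<close>, the empirical average of
  \<open>E[f | F\<^bsub>U\<^sub>i\<^esub>] - m\<close> depends only on the coordinates in the union of the \<open>U\<^sub>i\<close>, and given the spins it
  estimates \<open>h\<close> with a mean square error of order \<open>1/k\<close>. Thus \<open>h\<close> is reconstructed from the union
  with clue at least \<open>1 - 1/(k c)\<close>. To pass to a Boolean function, cut \<open>h\<close> at a level \<open>t\<close> for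
  which the estimate and \<open>h\<close> lie on different sides of \<open>t\<close> with probability much smaller than the
  variance of the cut; a random level with density proportional to the distance from a median of
  \<open>h\<close> has this property on average. Letting \<open>k\<close> grow slowly keeps the unions sparse.\<close>

section \<open>Independent copies of a random set\<close>

text \<open>Variances of independent copies add. Both claims go through one induction, because the
  cross term in the second moment vanishes by the first claim for the remaining \<open>k\<close>
  copies.\<close>

lemma sum_list_expectation_replicate_pmf:
  fixes Y :: "'b \<Rightarrow> real"
  assumes fin: "finite (set_pmf p)" and mean: "measure_pmf.expectation p Y = 0"
  shows "measure_pmf.expectation (replicate_pmf k p) (\<lambda>L. sum_list (map Y L)) = 0"
    and "measure_pmf.expectation (replicate_pmf k p) (\<lambda>L. (sum_list (map Y L))\<^sup>2)
      = k * measure_pmf.expectation p (\<lambda>x. (Y x)\<^sup>2)"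
proof (induction k)
  case 0
  show "measure_pmf.expectation (replicate_pmf 0 p) (\<lambda>L. sum_list (map Y L)) = 0"
    "measure_pmf.expectation (replicate_pmf 0 p) (\<lambda>L. (sum_list (map Y L))\<^sup>2)
      = real 0 * measure_pmf.expectation p (\<lambda>x. (Y x)\<^sup>2)"
    by simp_all
next
  case (Suc k)
  have fin_k: "finite (set_pmf (replicate_pmf k p))"
    using finite_lists_length_eq[OF fin, of k] by (simp add: set_replicate_pmf lists_eq_set)
  have int: "integrable (measure_pmf p) g" "integrable (measure_pmf (replicate_pmf k p)) h"
    for g :: "'b \<Rightarrow> real" and h :: "'b list \<Rightarrow> real"
    using fin fin_k by (auto intro: integrable_measure_pmf_finite)
  have step: "measure_pmf.expectation (replicate_pmf (Suc k) p) g
    = measure_pmf.expectation p (\<lambda>x. measure_pmf.expectation (replicate_pmf k p) (\<lambda>L. g (x # L)))"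
    for g :: "'b list \<Rightarrow> real"
    using fin fin_k
    by (simp add: pmf_expectation_bind[where A="set_pmf p"] integral_measure_pmf_real[where A="set_pmf p"]
        mult.commute map_pmf_def[symmetric] set_replicate_pmf)
  show "measure_pmf.expectation (replicate_pmf (Suc k) p) (\<lambda>L. sum_list (map Y L)) = 0"
    using Suc mean by (simp only: step) (simp add: int)
  show "measure_pmf.expectation (replicate_pmf (Suc k) p) (\<lambda>L. (sum_list (map Y L))\<^sup>2)
      = real (Suc k) * measure_pmf.expectation p (\<lambda>x. (Y x)\<^sup>2)"
    using Suc mean by (simp only: step) (simp add: int power2_sum algebra_simps)
qed

text \<open>Union bound over the \<open>k\<close> copies. It limits how much sparsity is lost by
  passing to the union.\<close>

lemma replicate_pmf_union_prob_le:
  "measure_pmf.prob (map_pmf (\<lambda>L. \<Union>(set L)) (replicate_pmf k p)) {U. j \<in> U}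
    \<le> k * measure_pmf.prob p {U. j \<in> U}"
proof (induction k)
  case 0
  then show ?case by simp
next
  case (Suc k)
  let ?q = "map_pmf (\<lambda>L. \<Union>(set L)) (replicate_pmf k p)"
  have "map_pmf (\<lambda>L. \<Union>(set L)) (replicate_pmf (Suc k) p) = map_pmf (\<lambda>(U, W). U \<union> W) (pair_pmf p ?q)"
    by (simp add: pair_pmf_def map_bind_pmf bind_map_pmf)
  then have "measure_pmf.prob (map_pmf (\<lambda>L. \<Union>(set L)) (replicate_pmf (Suc k) p)) {U. j \<in> U}
    = measure_pmf.prob (pair_pmf p ?q) (fst -` {U. j \<in> U} \<union> snd -` {U. j \<in> U})"
    by (simp del: replicate_pmf.simps) (rule arg_cong[where f="measure_pmf.prob _"], auto)
  also have "\<dots> \<le> measure_pmf.prob (pair_pmf p ?q) (fst -` {U. j \<in> U})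
      + measure_pmf.prob (pair_pmf p ?q) (snd -` {U. j \<in> U})"
    by (rule measure_Un_le) auto
  also have "\<dots> = measure_pmf.prob p {U. j \<in> U} + measure_pmf.prob ?q {U. j \<in> U}"
    by (simp only: measure_map_pmf[symmetric] map_fst_pair_pmf map_snd_pair_pmf)
  finally show ?case
    using Suc.IH by (simp add: algebra_simps)
qed

section \<open>Cutting at a random level\<close>

text \<open>The intervals are half-open so that the relation holds exactly when the tests
  \<open>t < a\<close> and \<open>t < b\<close> disagree, that is, when the cut at \<open>t\<close>
  gives \<open>a\<close> and \<open>b\<close> different signs.\<close>

definition separates :: "real \<Rightarrow> real \<Rightarrow> real \<Rightarrow> bool" where
  "separates t a b \<longleftrightarrow> (a \<le> t \<and> t < b) \<or> (b \<le> t \<and> t < a)"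

text \<open>The separating levels fill the interval between \<open>a\<close> and \<open>b\<close>,
  and \<open>t * \<bar>t\<bar>\<close> is an increasing antiderivative of the density.\<close>

lemma has_integral_separates:
  "((\<lambda>t. of_bool (separates t a b) * (2 * \<bar>t\<bar>)) has_integral \<bar>a * \<bar>a\<bar> - b * \<bar>b\<bar>\<bar>) UNIV"
proof -
  \<comment> \<open>The point 0 is treated through the difference quotient, since the absolute value
    has no derivative there.\<close>
  have deriv: "((\<lambda>t::real. t * \<bar>t\<bar>) has_real_derivative 2 * \<bar>t\<bar>) (at t within X)" for t X
  proof (cases "t = 0")
    case True
    have "((\<lambda>y::real. \<bar>y\<bar>) \<longlongrightarrow> 0) (at 0 within X)"
      by (rule tendsto_eq_intros refl | simp)+
    moreover have "\<forall>\<^sub>F y in at (0::real) within X. (y * \<bar>y\<bar> - 0 * \<bar>0\<bar>) / (y - 0) = \<bar>y\<bar>"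
      by (simp add: eventually_at_filter)
    ultimately show ?thesis
      unfolding True has_field_derivative_iff by (simp add: filterlim_cong)
  next
    case False
    have "(abs has_real_derivative sgn t) (at t within X)"
      using has_derivative_at_withinI[OF has_derivative_norm[OF False], of X]
      by (simp add: has_field_derivative_def real_norm_def[abs_def] mult_commute_abs)
    then have "((\<lambda>t::real. t * \<bar>t\<bar>) has_real_derivative 1 * \<bar>t\<bar> + sgn t * t) (at t within X)"
      by (intro DERIV_mult DERIV_ident)
    then show ?thesis
      by (simp add: abs_sgn mult.commute)
  qed
  have *: "((\<lambda>t. of_bool (separates t a b) * (2 * \<bar>t\<bar>)) has_integral \<bar>a * \<bar>a\<bar> - b * \<bar>b\<bar>\<bar>) UNIV"
    if "a \<le> b" for a b
  proof -
    have "((\<lambda>t. 2 * \<bar>t\<bar>) has_integral b * \<bar>b\<bar> - a * \<bar>a\<bar>) {a..b}"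
      using that deriv by (intro fundamental_theorem_of_calculus)
        (auto simp: has_real_derivative_iff_has_vector_derivative[symmetric])
    moreover from has_integral_nonneg[OF this] have "a * \<bar>a\<bar> \<le> b * \<bar>b\<bar>"
      by simp
    ultimately have "((\<lambda>t. if t \<in> {a..b} then 2 * \<bar>t\<bar> else 0) has_integral \<bar>a * \<bar>a\<bar> - b * \<bar>b\<bar>\<bar>) UNIV"
      unfolding has_integral_restrict_UNIV by simp
    then show ?thesis
      \<comment> \<open>The closed interval and the half-open set of separating levels differ only
        in the endpoint \<open>b\<close>.\<close>
      by (rule has_integral_spike_finite[of "{b}", rotated 2])
        (use that in \<open>auto simp: separates_def\<close>)
  qed
  show ?thesis
  proof (cases "a \<le> b")
    case True
    then show ?thesis by (rule *)
  next
    case False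
    then have "separates t a b = separates t b a" for t
      by (auto simp: separates_def)
    then show ?thesis
      using *[of b a] False by (simp add: abs_minus_commute)
  qed
qed

text \<open>The map \<open>x * \<bar>x\<bar>\<close> is Lipschitz between \<open>a\<close> and
  \<open>b\<close> with constant \<open>\<bar>a\<bar> + \<bar>b\<bar>\<close>. The resulting mixed
  product is split by a weighted arithmetic-geometric mean inequality with free weight
  \<open>r\<close>.\<close>

lemma abs_square_diff_le:
  fixes a b r :: real
  assumes "r > 0"
  shows "\<bar>a * \<bar>a\<bar> - b * \<bar>b\<bar>\<bar> \<le> r * a\<^sup>2 + (1 / r + 1) * (a - b)\<^sup>2"
proof -
  let ?d = "\<bar>a - b\<bar>"
  have "\<bar>a * \<bar>a\<bar> - b * \<bar>b\<bar>\<bar> \<le> ?d * (\<bar>a\<bar> + \<bar>b\<bar>)"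
  proof -
    have "a * \<bar>a\<bar> - b * \<bar>b\<bar> = (a - b) * \<bar>a\<bar> + b * (\<bar>a\<bar> - \<bar>b\<bar>)"
      by (simp add: algebra_simps)
    also have "\<bar>\<dots>\<bar> \<le> ?d * \<bar>a\<bar> + \<bar>b\<bar> * ?d"
      by (intro order_trans[OF abs_triangle_ineq] add_mono) (auto simp: abs_mult intro!: mult_left_mono)
    finally show ?thesis by (simp add: algebra_simps)
  qed
  also have "\<dots> \<le> ?d * (2 * \<bar>a\<bar> + ?d)"
    by (intro mult_left_mono) auto
  also have "\<dots> = 2 * \<bar>a\<bar> * ?d + (a - b)\<^sup>2"
    by (simp add: algebra_simps power2_eq_square)
  also have "2 * \<bar>a\<bar> * ?d \<le> r * a\<^sup>2 + (1 / r) * (a - b)\<^sup>2"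
  proof -
    have "0 \<le> (r * \<bar>a\<bar> - ?d)\<^sup>2 / r" using assms by simp
    also have "\<dots> = r * a\<^sup>2 + (1 / r) * (a - b)\<^sup>2 - 2 * \<bar>a\<bar> * ?d"
    proof -
      have "(r * \<bar>a\<bar> - ?d)\<^sup>2 = r * r * a\<^sup>2 + (a - b)\<^sup>2 - 2 * r * \<bar>a\<bar> * ?d"
        by (simp add: power2_diff power_mult_distrib) (simp add: power2_eq_square)
      then show ?thesis
        using assms by (simp add: diff_divide_distrib add_divide_distrib)
    qed
    finally show ?thesis by simp
  qed
  finally show ?thesis by (simp add: algebra_simps)
qed

text \<open>The level is chosen by averaging against the density \<open>2 * \<bar>t\<bar>\<close>, which turns the weight of
  the points where \<open>t\<close> lies between \<open>0\<close> and \<open>g\<close> into the second moment of \<open>g\<close>.\<close>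

lemma exists_stable_level:
  fixes g h w :: "'i \<Rightarrow> real"
  assumes I: "finite I" and w: "\<And>i. i \<in> I \<Longrightarrow> w i \<ge> 0" and r: "0 < r" "r \<le> 1"
    and pos: "(\<Sum>i\<in>I. w i * (g i)\<^sup>2) > 0"
    and close: "(\<Sum>i\<in>I. w i * (g i - h i)\<^sup>2) \<le> r\<^sup>2 * (\<Sum>i\<in>I. w i * (g i)\<^sup>2)"
  shows "\<exists>t. (\<Sum>i\<in>I. w i * of_bool (separates t 0 (g i))) > 0 \<and>
    (\<Sum>i\<in>I. w i * of_bool (separates t (g i) (h i)))
      \<le> 4 * r * (\<Sum>i\<in>I. w i * of_bool (separates t 0 (g i)))"
proof (rule ccontr)
  define p where "p t = (\<Sum>i\<in>I. w i * of_bool (separates t 0 (g i)))" for t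
  define D where "D t = (\<Sum>i\<in>I. w i * of_bool (separates t (g i) (h i)))" for t
  define G where "G = (\<Sum>i\<in>I. w i * (g i)\<^sup>2)"
  assume "\<not> ?thesis"
  then have *: "p t > 0 \<Longrightarrow> D t > 4 * r * p t" for t
    by (force simp: p_def D_def)
  have "p t \<ge> 0" "D t \<ge> 0" for t
    using w by (auto simp: p_def D_def intro!: sum_nonneg)
  \<comment> \<open>At levels with \<open>p t = 0\<close> the inequality only says that
    \<open>D t\<close> is nonnegative.\<close>
  then have le: "4 * r * p t \<le> D t" for t
    using *[of t] by (cases "p t > 0") (auto simp: antisym_conv1 not_less less_imp_le order.antisym)
  have int: "((\<lambda>t. (\<Sum>i\<in>I. w i * of_bool (separates t (a i) (b i))) * (2 * \<bar>t\<bar>))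
      has_integral (\<Sum>i\<in>I. w i * \<bar>a i * \<bar>a i\<bar> - b i * \<bar>b i\<bar>\<bar>)) UNIV" for a b
    unfolding sum_distrib_right mult.assoc
    by (intro has_integral_sum I has_integral_mult_right has_integral_separates)
  have "((\<lambda>t. p t * (2 * \<bar>t\<bar>)) has_integral G) UNIV"
    using int[of "\<lambda>_. 0" g] by (simp add: p_def G_def abs_mult power2_eq_square)
  from has_integral_mult_right[OF this, of "4 * r"]
  have "((\<lambda>t. 4 * r * p t * (2 * \<bar>t\<bar>)) has_integral 4 * r * G) UNIV"
    by (simp add: mult.assoc)
  moreover have "((\<lambda>t. D t * (2 * \<bar>t\<bar>))
      has_integral (\<Sum>i\<in>I. w i * \<bar>g i * \<bar>g i\<bar> - h i * \<bar>h i\<bar>\<bar>)) UNIV"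
    using int[of g h] by (simp add: D_def)
  \<comment> \<open>The assumed failure at every level is integrated against the density:
    \<open>p\<close> yields the second moment \<open>G\<close>, and \<open>D\<close> the weighted
    distances between \<open>g * \<bar>g\<bar>\<close> and \<open>h * \<bar>h\<bar>\<close>.\<close>
  ultimately have "4 * r * G \<le> (\<Sum>i\<in>I. w i * \<bar>g i * \<bar>g i\<bar> - h i * \<bar>h i\<bar>\<bar>)"
    by (rule has_integral_le) (intro mult_right_mono le, simp)
  also have "\<dots> \<le> (\<Sum>i\<in>I. w i * (r * (g i)\<^sup>2 + (1 / r + 1) * (g i - h i)\<^sup>2))"
    by (intro sum_mono mult_left_mono abs_square_diff_le w r)
  also have "\<dots> = r * G + (1 / r + 1) * (\<Sum>i\<in>I. w i * (g i - h i)\<^sup>2)"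
    unfolding G_def by (simp add: sum.distrib distrib_left sum_distrib_left mult_ac)
  also have "\<dots> \<le> r * G + (1 / r + 1) * (r\<^sup>2 * G)"
    using close r unfolding G_def by (intro add_left_mono mult_left_mono) auto
  also have "\<dots> = (2 + r) * r * G"
    using r by (simp add: power2_eq_square field_simps)
  \<comment> \<open>Here \<open>r \<le> 1\<close> enters. The factor 3 is below the assumed 4, which
    is absurd as \<open>G\<close> is positive.\<close>
  also have "\<dots> \<le> 3 * r * G"
    using r pos by (intro mult_right_mono) (auto simp: G_def)
  finally show False
    using r pos by (simp add: G_def)
qed

section \<open>Expectations on the finite configuration space\<close>

context spin_system
begin

lemma
  shows space_eq: "space M = V \<rightarrow>\<^sub>E \<Omega>"
    and sets_eq_Pow: "sets M = Pow (space M)"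
    and finite_space: "finite (space M)"
proof -
  have "sets M = sets (count_space (V \<rightarrow>\<^sub>E \<Omega>))"
    using finite_sites finite_spins
    by (simp add: sets_eq count_space_PiM_finite countable_finite)
  moreover from sets_eq_imp_space_eq[OF this] have "space M = V \<rightarrow>\<^sub>E \<Omega>"
    by simp
  ultimately show "space M = V \<rightarrow>\<^sub>E \<Omega>" "sets M = Pow (space M)" "finite (space M)"
    using finite_sites finite_spins by (auto intro: finite_PiE)
qed

lemma borel_measurable_all: "(f :: _ \<Rightarrow> real) \<in> borel_measurable M"
  by (auto simp: measurable_def sets_eq_Pow)

lemma integrable_all: "integrable M (f :: _ \<Rightarrow> real)"
proof (rule integrable_const_bound)
  show "AE \<omega> in M. norm (f \<omega>) \<le> Max (insert 0 ((\<lambda>\<omega>. norm (f \<omega>)) ` space M))"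
    using finite_space by (auto intro!: AE_I2 Max_ge)
qed (rule borel_measurable_all)

lemma expectation_eq_sum: "expectation f = (\<Sum>\<omega>\<in>space M. prob {\<omega>} * f \<omega>)"
  for f :: "_ \<Rightarrow> real"
proof -
  have "expectation f = expectation (\<lambda>x. \<Sum>\<omega>\<in>space M. indicator {\<omega>} x * f \<omega>)"
  proof (intro Bochner_Integration.integral_cong refl)
    fix x assume "x \<in> space M"
    then have "f x = (\<Sum>\<omega>\<in>space M. if x = \<omega> then f \<omega> else 0)"
      using finite_space by simp
    also have "\<dots> = (\<Sum>\<omega>\<in>space M. indicator {\<omega>} x * f \<omega>)"
      by (intro sum.cong) (auto simp: indicator_def)
    finally show "f x = (\<Sum>\<omega>\<in>space M. indicator {\<omega>} x * f \<omega>)" .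
  qed
  also have "\<dots> = (\<Sum>\<omega>\<in>space M. expectation (\<lambda>x. indicator {\<omega>} x * f \<omega>))"
    by (intro Bochner_Integration.integral_sum integrable_all)
  also have "\<dots> = (\<Sum>\<omega>\<in>space M. prob {\<omega>} * f \<omega>)"
    by (intro sum.cong refl) (auto simp: sets_eq_Pow Int_absorb2)
  finally show ?thesis .
qed

lemma prob_eq_sum: "prob {\<omega> \<in> space M. P \<omega>} = (\<Sum>\<omega>\<in>space M. prob {\<omega>} * of_bool (P \<omega>))"
proof -
  have "prob {\<omega> \<in> space M. P \<omega>} = expectation (indicator {\<omega> \<in> space M. P \<omega>})"
    by (simp add: sets_eq_Pow Int_absorb2)
  also have "\<dots> = (\<Sum>\<omega>\<in>space M. prob {\<omega>} * of_bool (P \<omega>))"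
    unfolding expectation_eq_sum by (intro sum.cong) (auto simp: indicator_def)
  finally show ?thesis .
qed

lemma variance_eq_moments: "variance f = expectation (\<lambda>\<omega>. (f \<omega>)\<^sup>2) - (expectation f)\<^sup>2" for f :: "_ \<Rightarrow> real"
  by (intro variance_eq integrable_all)

text \<open>Squares are written as products, the form in which conditional expectations are removed
  later.\<close>

lemma expectation_square_diff:
  fixes a b :: "_ \<Rightarrow> real"
  shows "expectation (\<lambda>\<omega>. (a \<omega> - b \<omega>)\<^sup>2) = expectation (\<lambda>\<omega>. a \<omega> * a \<omega>)
    - 2 * expectation (\<lambda>\<omega>. b \<omega> * a \<omega>) + expectation (\<lambda>\<omega>. b \<omega> * b \<omega>)"
proof -
  have "expectation (\<lambda>\<omega>. (a \<omega> - b \<omega>)\<^sup>2)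
      = expectation (\<lambda>\<omega>. a \<omega> * a \<omega> - 2 * (b \<omega> * a \<omega>) + b \<omega> * b \<omega>)"
    by (simp add: power2_eq_square algebra_simps)
  then show ?thesis
    by (simp only: Bochner_Integration.integral_add Bochner_Integration.integral_diff
        Bochner_Integration.integral_mult_right_zero integrable_all)
qed

section \<open>Conditional expectation on coordinates, and clue\<close>

lemma space_coord_algebra: "space (coord_algebra U) = space M"
  by (simp add: coord_algebra_def space_measure_of_conv)

lemma subalgebra_coord_algebra: "subalgebra M (coord_algebra U)"
  unfolding subalgebra_def sets_eq_Pow
  using sets.sets_into_space[of _ "coord_algebra U"] by (auto simp: space_coord_algebra)

lemma borel_measurable_coord_algebra_mono:
  assumes "U \<subseteq> W" "f \<in> borel_measurable (coord_algebra U)"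
  shows "f \<in> borel_measurable (coord_algebra W)"
proof -
  have "sets (coord_algebra U) \<subseteq> sets (coord_algebra W)"
    unfolding coord_algebra_def using assms(1)
    by (subst (1 2) sets_measure_of) (auto intro!: sigma_sets_mono')
  then show ?thesis
    by (intro measurable_from_subalg[OF _ assms(2)]) (simp add: subalgebra_def space_coord_algebra)
qed

text \<open>Fixing all of the finitely many coordinates isolates a configuration, so singletons, and
  then all sets of configurations, lie in the algebra.\<close>

lemma borel_measurable_coord_algebra_sites: "(f :: _ \<Rightarrow> real) \<in> borel_measurable (coord_algebra V)"
proof -
  have "{\<omega>} \<in> sets (coord_algebra V)" if "\<omega> \<in> space M" for \<omega>
  proof -
    have "{\<omega>'' \<in> space (coord_algebra V). \<forall>j\<in>V. \<omega>'' j = \<omega> j} \<in> sets (coord_algebra V)"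
    proof (intro sets.sets_Collect_finite_All finite_sites)
      fix j assume "j \<in> V"
      then have "{\<omega>' \<in> space M. \<omega>' j = \<omega> j} \<in> {{\<omega> \<in> space M. \<omega> j = a} | j a. j \<in> V \<and> a \<in> \<Omega>}"
        using that by (auto simp: space_eq)
      then show "{\<omega>' \<in> space (coord_algebra V). \<omega>' j = \<omega> j} \<in> sets (coord_algebra V)"
        unfolding space_coord_algebra by (subst coord_algebra_def, subst sets_measure_of) auto
    qed
    also have "{\<omega>'' \<in> space (coord_algebra V). \<forall>j\<in>V. \<omega>'' j = \<omega> j} = {\<omega>}"
      using that by (auto simp: space_coord_algebra space_eq intro: PiE_ext)
    finally show ?thesis .
  qed
  then have "A \<in> sets (coord_algebra V)" if "A \<subseteq> space M" for A
    using sets.countable[of A "coord_algebra V"] that finite_subset[OF that finite_space]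
    by (auto simp: countable_finite)
  then show ?thesis
    by (auto simp: measurable_def space_coord_algebra)
qed

lemma expectation_mult_cond_exp:
  assumes "Z \<in> borel_measurable (coord_algebra U)"
  shows "expectation (\<lambda>\<omega>. Z \<omega> * real_cond_exp M (coord_algebra U) f \<omega>) = expectation (\<lambda>\<omega>. Z \<omega> * f \<omega>)"
proof -
  interpret F: finite_measure_subalgebra M "coord_algebra U"
    by unfold_locales (rule subalgebra_coord_algebra)
  show ?thesis
    by (rule F.real_cond_exp_intg[OF integrable_all assms borel_measurable_all])
qed

lemma expectation_cond_exp: "expectation (real_cond_exp M (coord_algebra U) f) = expectation f"
  using expectation_mult_cond_exp[of "\<lambda>_. 1"] by simp

text \<open>The left side is the squared distance from \<open>f\<close> to its conditional
  expectation, which is the nearest function measurable for \<open>coord_algebra U\<close>.\<close>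

lemma variance_cond_exp_gap:
  assumes Y: "Y \<in> borel_measurable (coord_algebra U)"
  shows "variance f - variance (real_cond_exp M (coord_algebra U) f) \<le> expectation (\<lambda>\<omega>. (f \<omega> - Y \<omega>)\<^sup>2)"
proof -
  define C where "C = real_cond_exp M (coord_algebra U) f"
  have C: "C \<in> borel_measurable (coord_algebra U)"
    by (simp add: C_def)
  have YC: "expectation (\<lambda>\<omega>. Y \<omega> * C \<omega>) = expectation (\<lambda>\<omega>. Y \<omega> * f \<omega>)"
    and CC: "expectation (\<lambda>\<omega>. C \<omega> * C \<omega>) = expectation (\<lambda>\<omega>. C \<omega> * f \<omega>)"
    and mean: "expectation C = expectation f"
    unfolding C_def
    by (rule expectation_mult_cond_exp[OF Y] expectation_mult_cond_exp[OF C[unfolded C_def]] expectation_cond_exp)+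
  \<comment> \<open>This nonnegative quantity is exactly the slack in the claim, as \<open>Y\<close>
    pairs equally with \<open>C\<close> and with \<open>f\<close>.\<close>
  have "0 \<le> expectation (\<lambda>\<omega>. (C \<omega> - Y \<omega>)\<^sup>2)"
    by (rule Bochner_Integration.integral_nonneg) simp
  then have "0 \<le> expectation (\<lambda>\<omega>. C \<omega> * C \<omega>) - 2 * expectation (\<lambda>\<omega>. Y \<omega> * f \<omega>) + expectation (\<lambda>\<omega>. Y \<omega> * Y \<omega>)"
    by (simp add: expectation_square_diff YC)
  then show ?thesis
    using variance_eq_moments[of f] variance_eq_moments[of C] expectation_square_diff[of f Y]
    unfolding C_def[symmetric] mean power2_eq_square by linarith
qed

lemma clue_nonneg: "clue f U \<ge> 0"
  unfolding clue_def by (intro divide_nonneg_nonneg variance_positive)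

text \<open>Pythagoras: the residual is orthogonal to the conditional expectation, and the means
  agree.\<close>

lemma clue_le_1: "clue f U \<le> 1"
proof -
  let ?C = "real_cond_exp M (coord_algebra U) f"
  have "expectation (\<lambda>\<omega>. (f \<omega> - ?C \<omega>)\<^sup>2) = expectation (\<lambda>\<omega>. f \<omega> * f \<omega>) - expectation (\<lambda>\<omega>. ?C \<omega> * ?C \<omega>)"
    using expectation_mult_cond_exp[of ?C U f]
    by (simp add: expectation_square_diff)
  moreover have "expectation (\<lambda>\<omega>. (f \<omega> - ?C \<omega>)\<^sup>2) \<ge> 0"
    by (rule Bochner_Integration.integral_nonneg) simp
  ultimately have "variance ?C \<le> variance f"
    using variance_eq_moments[of f] variance_eq_moments[of ?C]
    unfolding expectation_cond_exp power2_eq_square by linarith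
  then show ?thesis
    unfolding clue_def using variance_positive[of f] by (intro divide_le_eq_1[THEN iffD2]) linarith
qed

text \<open>Any estimator \<open>Y\<close> computed from the coordinates in \<open>U\<close>
  certifies a lower bound on the clue, so the conditional expectation need not be computed.\<close>

lemma clue_ge:
  assumes "Y \<in> borel_measurable (coord_algebra U)" "variance f > 0"
  shows "clue f U \<ge> 1 - expectation (\<lambda>\<omega>. (f \<omega> - Y \<omega>)\<^sup>2) / variance f"
proof -
  have "1 - e / v \<le> a / v" if "v - a \<le> e" "v > 0" for v a e :: real
  proof -
    have "1 - e / v = (v - e) / v" using that by (simp add: diff_divide_distrib)
    also have "\<dots> \<le> a / v" using that by (intro divide_right_mono) auto
    finally show ?thesis .
  qed
  from this[OF variance_cond_exp_gap[OF assms(1)] assms(2)] show ?thesis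
    unfolding clue_def .
qed

lemma clue_sites: "variance f > 0 \<Longrightarrow> clue f V = 1"
  using clue_ge[of f V f] clue_le_1[of f V] borel_measurable_coord_algebra_sites[of f] by simp

section \<open>Medians, signs and joint averages\<close>

text \<open>The least value of \<open>g\<close> that is exceeded with probability at most 1/2 is a
  median.\<close>

lemma median_exists:
  fixes g :: "_ \<Rightarrow> real"
  shows "\<exists>m. prob {\<omega> \<in> space M. m < g \<omega>} \<le> 1 / 2 \<and> prob {\<omega> \<in> space M. g \<omega> < m} \<le> 1 / 2"
proof -
  let ?S = "space M"
  define T where "T = {v \<in> g ` ?S. prob {\<omega> \<in> ?S. v < g \<omega>} \<le> 1 / 2}"
  have fin: "finite (g ` ?S)" "g ` ?S \<noteq> {}"
    using finite_space not_empty by auto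
  have "{\<omega> \<in> ?S. Max (g ` ?S) < g \<omega>} = {}"
    using fin by (auto simp: not_less)
  then have "prob {\<omega> \<in> ?S. Max (g ` ?S) < g \<omega>} \<le> 1 / 2"
    by (simp only: measure_empty)
  then have "Max (g ` ?S) \<in> T"
    unfolding T_def using Max_in[OF fin] by blast
  then have "T \<noteq> {}" by blast
  moreover have "finite T"
    unfolding T_def using fin by simp
  ultimately have T: "finite T" "T \<noteq> {}" by blast+
  define m where "m = Min T"
  have m: "m \<in> T" unfolding m_def using T by (rule Min_in)
  have "prob {\<omega> \<in> ?S. g \<omega> < m} \<le> 1 / 2"
  proof (rule ccontr)
    assume *: "\<not> ?thesis"
    define L where "L = {v \<in> g ` ?S. v < m}"
    have "{\<omega> \<in> ?S. g \<omega> < m} \<noteq> {}" using * by (metis measure_empty not_less zero_le_divide_1_iff zero_le_numeral linorder_linear)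
    then have L: "finite L" "L \<noteq> {}" using fin by (auto simp: L_def)
    \<comment> \<open>No value of \<open>g\<close> lies strictly between \<open>v\<close> and
      \<open>m\<close>, so \<open>g < m\<close> and \<open>g > v\<close> are disjoint events. By
      minimality of \<open>m\<close> the second has probability above 1/2, which leaves too little
      for the first.\<close>
    define v where "v = Max L"
    have "v \<in> L" unfolding v_def using L by (rule Max_in)
    have "v \<notin> T"
    proof
      assume "v \<in> T"
      then have "m \<le> v" unfolding m_def using T by simp
      then show False using \<open>v \<in> L\<close> by (simp add: L_def)
    qed
    then have v: "prob {\<omega> \<in> ?S. v < g \<omega>} > 1 / 2"
      using \<open>v \<in> L\<close> by (auto simp: T_def L_def)
    have "g \<omega> \<le> v" if "\<omega> \<in> ?S" "g \<omega> < m" for \<omega>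
      unfolding v_def using L that by (intro Max_ge) (auto simp: L_def)
    then have "{\<omega> \<in> ?S. g \<omega> < m} \<inter> {\<omega> \<in> ?S. v < g \<omega>} = {}"
      by force
    then have "prob ({\<omega> \<in> ?S. g \<omega> < m} \<union> {\<omega> \<in> ?S. v < g \<omega>})
        = prob {\<omega> \<in> ?S. g \<omega> < m} + prob {\<omega> \<in> ?S. v < g \<omega>}"
      by (intro finite_measure_Union) (auto simp: sets_eq_Pow)
    then show False
      using v * prob_le_1[of "{\<omega> \<in> ?S. g \<omega> < m} \<union> {\<omega> \<in> ?S. v < g \<omega>}"] by linarith
  qed
  then show ?thesis
    using m by (auto simp: T_def)
qed

lemma variance_sign:
  shows "variance (\<lambda>\<omega>. if P \<omega> then 1 else (- 1 :: real)) = 4 * prob {\<omega> \<in> space M. P \<omega>} * (1 - prob {\<omega> \<in> space M. P \<omega>})"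
proof -
  let ?B = "\<lambda>\<omega>. if P \<omega> then 1 else (- 1 :: real)"
  have "expectation ?B = (\<Sum>\<omega>\<in>space M. prob {\<omega>} * (2 * of_bool (P \<omega>) - 1))"
    unfolding expectation_eq_sum by (intro sum.cong) auto
  also have "\<dots> = 2 * prob {\<omega> \<in> space M. P \<omega>} - expectation (\<lambda>_. 1)"
    unfolding expectation_eq_sum prob_eq_sum by (simp add: algebra_simps sum_subtractf sum_distrib_left)
  finally have "expectation ?B = 2 * prob {\<omega> \<in> space M. P \<omega>} - 1"
    by (simp add: prob_space)
  moreover have "expectation (\<lambda>\<omega>. (?B \<omega>)\<^sup>2) = 1"
    by (simp add: if_distrib[of "\<lambda>x. x\<^sup>2"] prob_space cong: if_cong)
  ultimately have "variance ?B = 1 - (2 * prob {\<omega> \<in> space M. P \<omega>} - 1)\<^sup>2"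
    using variance_eq_moments[of "?B"] by simp
  then show ?thesis
    by (simp add: power2_eq_square algebra_simps)
qed

lemma expectation_pmf_swap:
  fixes \<phi> :: "'b \<Rightarrow> _ \<Rightarrow> real"
  assumes "finite (set_pmf q)"
  shows "expectation (\<lambda>\<omega>. measure_pmf.expectation q (\<lambda>x. \<phi> x \<omega>)) = measure_pmf.expectation q (\<lambda>x. expectation (\<phi> x))"
  using assms by (simp add: integral_measure_pmf_real[where A="set_pmf q"] integrable_all)

text \<open>Puts the product of the spin law and an independent law into the form of a finite
  weighted sum, as required by \<open>exists_stable_level\<close>.\<close>

lemma sum_joint_weights:
  fixes \<phi> :: "'b \<Rightarrow> _ \<Rightarrow> real"
  assumes "finite (set_pmf q)"
  shows "(\<Sum>(\<omega>, x)\<in>space M \<times> set_pmf q. prob {\<omega>} * pmf q x * \<phi> x \<omega>) = measure_pmf.expectation q (\<lambda>x. expectation (\<phi> x))"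
  using assms
  by (simp add: integral_measure_pmf_real[where A="set_pmf q"] expectation_eq_sum sum.cartesian_product[symmetric]
      sum_distrib_right sum_distrib_left mult_ac sum.swap[of _ "set_pmf q"])

lemma expected_clue_le_1: "expected_clue f \<nu> \<le> 1"
proof -
  have "integrable (measure_pmf \<nu>) (clue f)"
    by (rule measure_pmf.integrable_const_bound[where B=1]) (auto simp: clue_nonneg clue_le_1)
  then have "measure_pmf.expectation \<nu> (clue f) \<le> measure_pmf.expectation \<nu> (\<lambda>_. 1)"
    by (intro integral_mono) (auto simp: clue_le_1)
  then show ?thesis by (simp add: expected_clue_def)
qed

section \<open>Amplification to a Boolean function\<close>

text \<open>With \<open>r = 1 / sqrt (k * c)\<close>, the constant 8 is 4 from the stable level,
  times 4 from the squared difference of two signs, divided by 2 from the variance bound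
  \<open>2 * p\<close>.\<close>

lemma boolean_amplification:
  assumes supp: "set_pmf \<nu> \<subseteq> Pow V" and c: "0 < c" "c < expected_clue f \<nu>" and k: "k > 0"
  shows "\<exists>B. (\<forall>\<omega>. B \<omega> \<in> {-1, 1 :: real}) \<and>
    expected_clue B (map_pmf (\<lambda>L. \<Union>(set L)) (replicate_pmf k \<nu>)) \<ge> 1 - 8 / sqrt (k * c)"
proof (cases "k * c < 1")
  case True
  \<comment> \<open>The claimed lower bound is then at most 0, so a constant function
    serves.\<close>
  then have "8 / sqrt (k * c) \<ge> 1"
    using c k by (simp add: le_divide_eq_1) (metis less_eq_real_def order_trans one_le_numeral real_sqrt_le_1_iff)
  moreover have "expected_clue (\<lambda>_. 1) (map_pmf (\<lambda>L. \<Union>(set L)) (replicate_pmf k \<nu>)) \<ge> 0"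
    unfolding expected_clue_def by (intro Bochner_Integration.integral_nonneg clue_nonneg)
  ultimately show ?thesis
    by (intro exI[of _ "\<lambda>_. 1"]) auto
next
  case False
  \<comment> \<open>\<open>r\<close> will bound the root mean square error of \<open>avg\<close>
    relative to the size of \<open>h - m0\<close>.\<close>
  define r where "r = 1 / sqrt (k * c)"
  have r: "0 < r" "r \<le> 1" "r\<^sup>2 = 1 / (k * c)"
    using False c k by (auto simp: r_def power_divide divide_le_eq_1)
  define R where "R = replicate_pmf k \<nu>"
  have fin: "finite (set_pmf \<nu>)"
    using supp finite_sites finite_subset by blast
  have fin_R: "finite (set_pmf R)"
    unfolding R_def using finite_lists_length_eq[OF fin, of k] by (simp add: set_replicate_pmf lists_eq_set)
  have int: "integrable (measure_pmf \<nu>) u" "integrable (measure_pmf R) v"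
    for u :: "_ \<Rightarrow> real" and v :: "_ \<Rightarrow> real"
    using fin fin_R by (auto intro: integrable_measure_pmf_finite)
  define C where "C U = real_cond_exp M (coord_algebra U) f" for U
  define m where "m = expectation f"
  define X where "X U \<omega> = C U \<omega> - m" for U \<omega>
  define h where "h \<omega> = measure_pmf.expectation \<nu> (\<lambda>U. X U \<omega>)" for \<omega>
  define A where "A = measure_pmf.expectation \<nu> (\<lambda>U. variance (C U))"
  define v where "v = variance f"
  define avg where "avg L \<omega> = sum_list (map (\<lambda>U. X U \<omega>) L) / k" for L \<omega>

  have clue_f: "expected_clue f \<nu> = A / v"
    by (simp add: expected_clue_def clue_def[abs_def] A_def v_def C_def)
  have "v \<ge> 0" unfolding v_def by (rule variance_positive)
  \<comment> \<open>If \<open>v\<close> were 0, the quotient \<open>A / v\<close> would be 0 and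
    could not exceed \<open>c\<close>.\<close>
  then have v: "v > 0"
    using c clue_f by (cases "v = 0") auto
  have A: "A > c * v"
    using c v by (simp add: clue_f field_simps)
  then have A_pos: "A > 0"
    using c v by (meson less_trans mult_pos_pos)

  have f_sq: "expectation (\<lambda>\<omega>. (f \<omega> - m)\<^sup>2) = v"
    by (simp only: v_def m_def)
  have C_mean: "expectation (C U) = m" for U
    unfolding C_def m_def by (rule expectation_cond_exp)
  have X_mean: "expectation (X U) = 0" for U
    unfolding X_def by (simp add: integrable_all C_mean prob_space)
  have X_sq: "expectation (\<lambda>\<omega>. (X U \<omega>)\<^sup>2) = variance (C U)" for U
    unfolding X_def C_mean ..
  have X_meas: "X U \<in> borel_measurable (coord_algebra U)" for U
    unfolding X_def[abs_def] C_def by measurable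
  \<comment> \<open>\<open>X U\<close> is centred and measurable for \<open>coord_algebra U\<close>,
    so it pairs with \<open>f - m\<close> as it does with itself.\<close>
  have X_f: "expectation (\<lambda>\<omega>. X U \<omega> * (f \<omega> - m)) = variance (C U)" for U
  proof -
    have "expectation (\<lambda>\<omega>. X U \<omega> * (f \<omega> - m)) = expectation (\<lambda>\<omega>. X U \<omega> * f \<omega>)"
      using X_mean[of U] by (simp add: right_diff_distrib integrable_all)
    also have "\<dots> = expectation (\<lambda>\<omega>. X U \<omega> * C U \<omega>)"
      unfolding C_def by (rule expectation_mult_cond_exp[OF X_meas, symmetric])
    also have "\<dots> = expectation (\<lambda>\<omega>. (X U \<omega>)\<^sup>2 + m * X U \<omega>)"
      by (simp add: X_def power2_eq_square algebra_simps)
    also have "\<dots> = variance (C U)"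
      using X_mean[of U] X_sq[of U] by (simp add: integrable_all)
    finally show ?thesis .
  qed
  have h_mean: "expectation h = 0"
    unfolding h_def[abs_def] by (simp add: expectation_pmf_swap[OF fin] X_mean)
  have h_f: "expectation (\<lambda>\<omega>. h \<omega> * (f \<omega> - m)) = A"
  proof -
    have "expectation (\<lambda>\<omega>. h \<omega> * (f \<omega> - m))
        = expectation (\<lambda>\<omega>. measure_pmf.expectation \<nu> (\<lambda>U. X U \<omega> * (f \<omega> - m)))"
      by (simp add: h_def)
    then show ?thesis
      by (simp only: expectation_pmf_swap[OF fin] X_f A_def)
  qed
  have h_sq: "expectation (\<lambda>\<omega>. (h \<omega>)\<^sup>2) \<ge> A\<^sup>2 / v"
  proof -
    \<comment> \<open>Cauchy-Schwarz, by expanding the square of the residual: \<open>?s\<close> is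
      the coefficient of the projection of \<open>h\<close> onto \<open>f - m\<close>.\<close>
    let ?s = "A / v"
    have "0 \<le> expectation (\<lambda>\<omega>. (h \<omega> - ?s * (f \<omega> - m))\<^sup>2)"
      by (rule Bochner_Integration.integral_nonneg) simp
    also have "\<dots> = expectation (\<lambda>\<omega>. (h \<omega>)\<^sup>2 - 2 * ?s * (h \<omega> * (f \<omega> - m)) + ?s\<^sup>2 * (f \<omega> - m)\<^sup>2)"
      by (intro Bochner_Integration.integral_cong refl) (simp only: power2_eq_square, simp add: algebra_simps)
    also have "\<dots> = expectation (\<lambda>\<omega>. (h \<omega>)\<^sup>2) - 2 * ?s * A + ?s\<^sup>2 * v"
      by (simp only: Bochner_Integration.integral_add Bochner_Integration.integral_diff
          Bochner_Integration.integral_mult_right_zero integrable_all h_f f_sq)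
    also have "\<dots> = expectation (\<lambda>\<omega>. (h \<omega>)\<^sup>2) - A\<^sup>2 / v"
      using v by (simp add: power2_eq_square field_simps)
    finally show ?thesis by simp
  qed

  \<comment> \<open>For fixed spins, \<open>avg\<close> is the mean of \<open>k\<close> independent
    copies with expectation \<open>h \<omega>\<close>. Their variance is bounded by the second
    moment.\<close>
  have avg_error: "measure_pmf.expectation R (\<lambda>L. (h \<omega> - avg L \<omega>)\<^sup>2)
      \<le> measure_pmf.expectation \<nu> (\<lambda>U. (X U \<omega>)\<^sup>2) / k" for \<omega>
  proof -
    let ?Y = "\<lambda>U. X U \<omega> - h \<omega>"
    have "(h \<omega> - avg L \<omega>)\<^sup>2 = (sum_list (map ?Y L))\<^sup>2 / (real k)\<^sup>2" if "L \<in> set_pmf R" for L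
    proof -
      have "length L = k" using that by (simp add: R_def set_replicate_pmf)
      then have "sum_list (map ?Y L) = k * (avg L \<omega> - h \<omega>)"
        using k by (simp add: avg_def sum_list_subtractf sum_list_triv right_diff_distrib)
      then show ?thesis using k by (simp add: power_mult_distrib power2_commute)
    qed
    then have "measure_pmf.expectation R (\<lambda>L. (h \<omega> - avg L \<omega>)\<^sup>2)
        = measure_pmf.expectation R (\<lambda>L. (sum_list (map ?Y L))\<^sup>2 / (real k)\<^sup>2)"
      by (intro integral_cong_AE) (auto simp: AE_measure_pmf_iff)
    also have "\<dots> = measure_pmf.expectation \<nu> (\<lambda>U. (?Y U)\<^sup>2) / k"
    proof -
      have "measure_pmf.expectation \<nu> ?Y = 0" by (simp add: int h_def)
      from sum_list_expectation_replicate_pmf(2)[OF fin this, of k] show ?thesis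
        using k by (simp add: R_def power2_eq_square)
    qed
    also have "measure_pmf.expectation \<nu> (\<lambda>U. (?Y U)\<^sup>2) = measure_pmf.expectation \<nu> (\<lambda>U. (X U \<omega>)\<^sup>2) - (h \<omega>)\<^sup>2"
      using measure_pmf.variance_eq[of \<nu> "\<lambda>U. X U \<omega>"] by (simp add: int h_def)
    finally show ?thesis
      using k by (simp add: divide_right_mono order_trans)
  qed
  have error: "measure_pmf.expectation R (\<lambda>L. expectation (\<lambda>\<omega>. (h \<omega> - avg L \<omega>)\<^sup>2)) \<le> A / k"
  proof -
    have "measure_pmf.expectation R (\<lambda>L. expectation (\<lambda>\<omega>. (h \<omega> - avg L \<omega>)\<^sup>2))
        \<le> expectation (\<lambda>\<omega>. measure_pmf.expectation \<nu> (\<lambda>U. (X U \<omega>)\<^sup>2) / k)"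
      unfolding expectation_pmf_swap[OF fin_R, symmetric]
      by (intro integral_mono integrable_all avg_error)
    also have "\<dots> = A / k"
      by (simp add: expectation_pmf_swap[OF fin] X_sq A_def)
    finally show ?thesis .
  qed

  \<comment> \<open>Measuring levels from a median ensures that the part of \<open>h\<close> beyond
    any level has probability at most 1/2.\<close>
  obtain m0 where m0: "prob {\<omega> \<in> space M. m0 < h \<omega>} \<le> 1 / 2" "prob {\<omega> \<in> space M. h \<omega> < m0} \<le> 1 / 2"
    using median_exists by blast
  define I where "I = space M \<times> set_pmf R"
  define w where "w = (\<lambda>(\<omega>, L). prob {\<omega>} * pmf R L)"
  define g where "g = (\<lambda>(\<omega>, L :: 'v set list). h \<omega> - m0)"
  define g' where "g' = (\<lambda>(\<omega>, L). avg L \<omega> - m0)"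
  have joint: "(\<Sum>i\<in>I. w i * \<phi> (g i) (g' i)) = measure_pmf.expectation R (\<lambda>L. expectation (\<lambda>\<omega>. \<phi> (h \<omega> - m0) (avg L \<omega> - m0)))"
    for \<phi> :: "real \<Rightarrow> real \<Rightarrow> real"
    unfolding I_def sum_joint_weights[OF fin_R, symmetric]
    by (intro sum.cong) (auto simp: w_def g_def g'_def)
  have g_sq: "(\<Sum>i\<in>I. w i * (g i)\<^sup>2) \<ge> A\<^sup>2 / v"
  proof -
    have "(\<Sum>i\<in>I. w i * (g i)\<^sup>2) = expectation (\<lambda>\<omega>. (h \<omega> - m0)\<^sup>2)"
      using joint[of "\<lambda>a b. a\<^sup>2"] by simp
    also have "\<dots> = expectation (\<lambda>\<omega>. (h \<omega>)\<^sup>2 - 2 * m0 * h \<omega> + m0\<^sup>2)"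
      by (simp add: power2_diff algebra_simps)
    \<comment> \<open>As \<open>h\<close> is centred, recentring at the median can only increase the
      second moment.\<close>
    also have "\<dots> = expectation (\<lambda>\<omega>. (h \<omega>)\<^sup>2) + m0\<^sup>2"
      by (simp add: integrable_all h_mean prob_space)
    finally show ?thesis using h_sq zero_le_power2[of m0] by linarith
  qed
  moreover have "A\<^sup>2 / v > 0" using A_pos v by simp
  ultimately have g_pos: "(\<Sum>i\<in>I. w i * (g i)\<^sup>2) > 0" by linarith
  have close: "(\<Sum>i\<in>I. w i * (g i - g' i)\<^sup>2) \<le> r\<^sup>2 * (\<Sum>i\<in>I. w i * (g i)\<^sup>2)"
  proof -
    have "(\<Sum>i\<in>I. w i * (g i - g' i)\<^sup>2) \<le> A / k"
      using joint[of "\<lambda>a b. (a - b)\<^sup>2"] error by simp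
    also have "\<dots> \<le> r\<^sup>2 * (A\<^sup>2 / v)"
    proof -
      \<comment> \<open>The gain \<open>c\<close> comes from \<open>A > c * v\<close>, which turns
        \<open>A / k\<close> into at most \<open>A\<^sup>2 / (k * c * v)\<close>.\<close>
      have "c * v * A \<le> A * A" using A A_pos by (intro mult_right_mono) auto
      then have "c * v * A / (k * c * v) \<le> A * A / (k * c * v)"
        using c v k by (intro divide_right_mono) auto
      then show ?thesis
        using c v unfolding r(3) by (simp add: power2_eq_square mult_ac)
    qed
    also have "\<dots> \<le> r\<^sup>2 * (\<Sum>i\<in>I. w i * (g i)\<^sup>2)"
      using g_sq by (intro mult_left_mono) auto
    finally show ?thesis .
  qed
  have "finite I" "\<And>i. w i \<ge> 0"
    using finite_space fin_R by (auto simp: I_def w_def)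
  from exists_stable_level[OF this r(1,2) g_pos close] obtain t where
    p_pos: "(\<Sum>i\<in>I. w i * of_bool (separates t 0 (g i))) > 0" and
    stable: "(\<Sum>i\<in>I. w i * of_bool (separates t (g i) (g' i)))
      \<le> 4 * r * (\<Sum>i\<in>I. w i * of_bool (separates t 0 (g i)))"
    by blast
  define p where "p = prob {\<omega> \<in> space M. separates t 0 (h \<omega> - m0)}"
  have p: "(\<Sum>i\<in>I. w i * of_bool (separates t 0 (g i))) = p"
    using joint[of "\<lambda>a b. of_bool (separates t 0 a)"] by (simp add: p_def prob_eq_sum expectation_eq_sum)
  define B where "B \<omega> = (if t < h \<omega> - m0 then 1 else - 1 :: real)" for \<omega>
  define B' where "B' L \<omega> = (if t < avg L \<omega> - m0 then 1 else - 1 :: real)" for L \<omega>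
  \<comment> \<open>The event measured by \<open>p\<close> is \<open>B = 1\<close> for
    \<open>t \<ge> 0\<close> and \<open>B = -1\<close> for \<open>t < 0\<close>. By the choice of
    \<open>m0\<close> it has probability at most 1/2, so
    \<open>4 * p * (1 - p) \<ge> 2 * p\<close>.\<close>
  have var_B: "variance B \<ge> 2 * p"
  proof -
    define q where "q = prob {\<omega> \<in> space M. t < h \<omega> - m0}"
    have var: "variance B = 4 * q * (1 - q)"
      unfolding B_def[abs_def] q_def by (rule variance_sign)
    have "(p = q \<or> p = 1 - q) \<and> p \<le> 1 / 2"
    proof (cases "t \<ge> 0")
      case True
      then have "p = q"
        by (auto simp: p_def q_def separates_def intro!: arg_cong[where f=prob])
      moreover have "p \<le> prob {\<omega> \<in> space M. m0 < h \<omega>}"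
        unfolding p_def using True by (intro finite_measure_mono) (auto simp: separates_def sets_eq_Pow)
      ultimately show ?thesis using m0 by auto
    next
      case False
      have "p = prob (space M - {\<omega> \<in> space M. t < h \<omega> - m0})"
        unfolding p_def using False by (intro arg_cong[where f=prob]) (auto simp: separates_def)
      also have "\<dots> = 1 - q"
        unfolding q_def by (intro prob_compl) (auto simp: sets_eq_Pow)
      finally have "p = 1 - q" .
      moreover have "p \<le> prob {\<omega> \<in> space M. h \<omega> < m0}"
        unfolding p_def using False by (intro finite_measure_mono) (auto simp: separates_def sets_eq_Pow)
      ultimately show ?thesis using m0 by auto
    qed
    then have "variance B = 4 * p * (1 - p)" "p \<le> 1 / 2" using var by auto
    moreover have "p * (1 / 2) \<le> p * (1 - p)" if "p \<le> 1 / 2"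
      using that by (intro mult_left_mono) (auto simp: p_def)
    ultimately show ?thesis by simp
  qed
  have p_pos: "p > 0" using p_pos p by simp
  then have var_pos: "variance B > 0" using var_B by linarith
  have B_error: "measure_pmf.expectation R (\<lambda>L. expectation (\<lambda>\<omega>. (B \<omega> - B' L \<omega>)\<^sup>2)) \<le> 16 * r * p"
  proof -
    have "(B \<omega> - B' L \<omega>)\<^sup>2 = 4 * of_bool (separates t (h \<omega> - m0) (avg L \<omega> - m0))" for L \<omega>
      by (auto simp: B_def B'_def separates_def)
    then have "measure_pmf.expectation R (\<lambda>L. expectation (\<lambda>\<omega>. (B \<omega> - B' L \<omega>)\<^sup>2))
        = 4 * (\<Sum>i\<in>I. w i * of_bool (separates t (g i) (g' i)))"
      using joint[of "\<lambda>a b. of_bool (separates t a b)"] by simp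
    then show ?thesis using stable unfolding p by linarith
  qed
  have B'_meas: "B' L \<in> borel_measurable (coord_algebra (\<Union>(set L)))" for L
  proof -
    \<comment> \<open>The induction runs over a separate list \<open>L'\<close>, so that the algebra
      of the full union stays fixed.\<close>
    have "(\<lambda>\<omega>. sum_list (map (\<lambda>U. X U \<omega>) L')) \<in> borel_measurable (coord_algebra (\<Union>(set L)))"
      if "set L' \<subseteq> set L" for L'
      using that
    proof (induction L')
      case (Cons U L')
      then have "X U \<in> borel_measurable (coord_algebra (\<Union>(set L)))"
        by (intro borel_measurable_coord_algebra_mono[OF _ X_meas]) auto
      then show ?case using Cons by simp
    qed simp
    from this[of L] have "avg L \<in> borel_measurable (coord_algebra (\<Union>(set L)))"
      unfolding avg_def[abs_def] by simp
    then show ?thesis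
      unfolding B'_def[abs_def] by measurable
  qed
  have "1 - 8 * r \<le> 1 - 16 * r * p / variance B"
    using var_B var_pos r by (simp add: field_simps)
  also have "\<dots> \<le> 1 - measure_pmf.expectation R (\<lambda>L. expectation (\<lambda>\<omega>. (B \<omega> - B' L \<omega>)\<^sup>2)) / variance B"
    using B_error var_pos by (simp add: divide_right_mono)
  also have "\<dots> = measure_pmf.expectation R (\<lambda>L. 1 - expectation (\<lambda>\<omega>. (B \<omega> - B' L \<omega>)\<^sup>2) / variance B)"
    by (simp add: int)
  also have "\<dots> \<le> measure_pmf.expectation R (\<lambda>L. clue B (\<Union>(set L)))"
    by (intro integral_mono int clue_ge B'_meas var_pos)
  also have "\<dots> = expected_clue B (map_pmf (\<lambda>L. \<Union>(set L)) R)"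
    by (simp add: expected_clue_def)
  finally show ?thesis
    by (intro exI[of _ B]) (auto simp: B_def R_def r_def)
qed

section \<open>Consequences of not being a point mass\<close>

text \<open>Without sites there is a single configuration, carrying all the mass. Nonemptiness gives
  meaning to the maximum in \<open>sparse_random_subsets\<close>.\<close>

lemma sites_nonempty:
  assumes "\<And>\<omega>. prob {\<omega>} \<noteq> 1"
  shows "V \<noteq> {}"
proof
  assume "V = {}"
  then have "space M = {\<lambda>_. undefined}" by (simp add: space_eq)
  then show False using prob_space assms by metis
qed

text \<open>The sign that singles out a configuration of probability strictly between 0 and 1 has
  positive variance. It will replace \<open>f n\<close> at finitely many indices.\<close>

lemma boolean_clue_sites_eq_1:
  assumes "\<And>\<omega>. prob {\<omega>} \<noteq> 1"
  shows "\<exists>B. (\<forall>\<omega>. B \<omega> \<in> {-1, 1 :: real}) \<and> clue B V = 1"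
proof -
  have "(\<Sum>\<omega>\<in>space M. prob {\<omega>}) = 1"
    using expectation_eq_sum[of "\<lambda>_. 1"] by (simp add: prob_space)
  then have "(\<Sum>\<omega>\<in>space M. prob {\<omega>}) \<noteq> 0"
    by simp
  then obtain \<omega> where \<omega>: "\<omega> \<in> space M" "prob {\<omega>} \<noteq> 0"
    by (rule sum.not_neutral_contains_not_neutral)
  then have q: "0 < prob {\<omega>}" "prob {\<omega>} < 1"
    using assms[of \<omega>] prob_le_1[of "{\<omega>}"] measure_nonneg[of M "{\<omega>}"] by linarith+
  define B where "B \<omega>' = (if \<omega>' = \<omega> then 1 else - 1 :: real)" for \<omega>'
  have "{\<omega>' \<in> space M. \<omega>' = \<omega>} = {\<omega>}" using \<omega> by auto
  then have "variance B = 4 * prob {\<omega>} * (1 - prob {\<omega>})"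
    using variance_sign[of "\<lambda>\<omega>'. \<omega>' = \<omega>"] unfolding B_def by simp
  then have "clue B V = 1"
    using q by (intro clue_sites) simp
  then show ?thesis
    by (intro exI[of _ B]) (simp add: B_def)
qed

end

section \<open>Sparse sequences and the equivalence\<close>

lemma sparse_random_subsets_change_finite:
  assumes "sparse_random_subsets V \<nu>" "\<And>n. set_pmf (\<nu>' n) \<subseteq> Pow (V n)"
    and "\<forall>\<^sub>F n in sequentially. \<nu>' n = \<nu> n"
  shows "sparse_random_subsets V \<nu>'"
  unfolding sparse_random_subsets_def
proof (intro conjI allI assms(2))
  have "(\<lambda>n. MAX j\<in>V n. measure_pmf.prob (\<nu> n) {U. j \<in> U}) \<longlonglongrightarrow> 0"
    using assms(1) by (simp add: sparse_random_subsets_def)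
  then show "(\<lambda>n. MAX j\<in>V n. measure_pmf.prob (\<nu>' n) {U. j \<in> U}) \<longlonglongrightarrow> 0"
    by (rule Lim_transform_eventually) (use assms(3) in eventually_elim, simp)
qed

text \<open>Taking \<open>k\<close> of order \<open>1 / sqrt s\<close> sends \<open>k\<close> to
  infinity while \<open>k * s\<close> is of order \<open>sqrt s\<close>.\<close>

lemma vanishing_multiplier:
  fixes s :: "nat \<Rightarrow> real"
  assumes s: "s \<longlonglongrightarrow> 0" and nonneg: "\<And>n. s n \<ge> 0"
  obtains k :: "nat \<Rightarrow> nat" where "\<And>n. k n > 0" "(\<lambda>n. 1 / k n) \<longlonglongrightarrow> 0" "(\<lambda>n. k n * s n) \<longlonglongrightarrow> 0"
proof
  \<comment> \<open>The added term keeps \<open>e\<close> positive where \<open>s\<close>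
    vanishes.\<close>
  define e where "e n = s n + 1 / real (Suc n)" for n
  define k where "k n = nat \<lceil>1 / sqrt (e n)\<rceil>" for n
  have "e \<longlonglongrightarrow> 0 + 0"
    unfolding e_def[abs_def] by (intro tendsto_add s LIMSEQ_Suc lim_1_over_n)
  then have e: "e \<longlonglongrightarrow> 0" "(\<lambda>n. sqrt (e n)) \<longlonglongrightarrow> 0"
    using tendsto_real_sqrt by fastforce+
  have e_pos: "e n > 0" for n
    using nonneg[of n] by (simp add: e_def add_nonneg_pos)
  have k_ge: "1 / sqrt (e n) \<le> k n" and k_le: "k n \<le> 1 / sqrt (e n) + 1" for n
  proof -
    have "0 < 1 / sqrt (e n)" using e_pos[of n] by simp
    then show "1 / sqrt (e n) \<le> k n" "k n \<le> 1 / sqrt (e n) + 1"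
      unfolding k_def by linarith+
  qed
  have pos: "0 < 1 / sqrt (e n)" for n using e_pos[of n] by simp
  show k_pos: "k n > 0" for n
    using k_ge[of n] pos[of n] by (metis le_less_trans not_less of_nat_0 gr0I less_irrefl)
  have "1 / k n \<le> sqrt (e n)" for n
    using k_ge[of n] k_pos[of n] e_pos[of n] by (simp add: field_simps)
  then show "(\<lambda>n. 1 / k n) \<longlonglongrightarrow> 0"
    by (intro real_tendsto_sandwich[OF _ _ tendsto_const e(2)]) auto
  have "k n * s n \<le> sqrt (e n) + e n" for n
  proof -
    have "k n * s n \<le> (1 / sqrt (e n) + 1) * e n"
      using k_le[of n] nonneg[of n] e_pos[of n] by (intro mult_mono) (auto simp: e_def)
    also have "\<dots> = sqrt (e n) + e n"
      using e_pos[of n] by (simp add: distrib_right real_div_sqrt)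
    finally show ?thesis .
  qed
  moreover have lim: "(\<lambda>n. sqrt (e n) + e n) \<longlonglongrightarrow> 0"
    using tendsto_add[OF e(2,1)] by simp
  ultimately show "(\<lambda>n. k n * s n) \<longlonglongrightarrow> 0"
    using nonneg by (intro real_tendsto_sandwich[OF _ _ tendsto_const lim]) auto
qed

text \<open>By the union bound, the largest marginal grows by a factor of at most
  \<open>k n\<close>.\<close>

lemma sparse_random_subsets_union:
  assumes V: "\<And>n. finite (V n)" "\<And>n. V n \<noteq> {}"
    and supp: "\<And>n. set_pmf (\<nu> n) \<subseteq> Pow (V n)"
    and lim: "(\<lambda>n. k n * (MAX j\<in>V n. measure_pmf.prob (\<nu> n) {U. j \<in> U})) \<longlonglongrightarrow> 0"
  shows "sparse_random_subsets V (\<lambda>n. map_pmf (\<lambda>L. \<Union>(set L)) (replicate_pmf (k n) (\<nu> n)))"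
  unfolding sparse_random_subsets_def
proof (intro conjI allI)
  fix n
  show "set_pmf (map_pmf (\<lambda>L. \<Union>(set L)) (replicate_pmf (k n) (\<nu> n))) \<subseteq> Pow (V n)"
    using supp[of n] by (auto simp: set_replicate_pmf lists_eq_set)
next
  let ?m = "\<lambda>n. MAX j\<in>V n. measure_pmf.prob (map_pmf (\<lambda>L. \<Union>(set L)) (replicate_pmf (k n) (\<nu> n))) {U. j \<in> U}"
  have "0 \<le> ?m n" for n
  proof -
    obtain j where "j \<in> V n" using V(2) by blast
    then show ?thesis
      using V(1) by (intro order_trans[OF measure_nonneg Max_ge]) auto
  qed
  moreover have "?m n \<le> k n * (MAX j\<in>V n. measure_pmf.prob (\<nu> n) {U. j \<in> U})" for n
  proof (intro Max.boundedI)
    fix x assume "x \<in> (\<lambda>j. measure_pmf.prob (map_pmf (\<lambda>L. \<Union>(set L)) (replicate_pmf (k n) (\<nu> n))) {U. j \<in> U}) ` V n"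
    then obtain j where j: "j \<in> V n"
      "x = measure_pmf.prob (map_pmf (\<lambda>L. \<Union>(set L)) (replicate_pmf (k n) (\<nu> n))) {U. j \<in> U}"
      by blast
    have "x \<le> k n * measure_pmf.prob (\<nu> n) {U. j \<in> U}"
      unfolding j(2) by (rule replicate_pmf_union_prob_le)
    also have "\<dots> \<le> k n * (MAX j\<in>V n. measure_pmf.prob (\<nu> n) {U. j \<in> U})"
      using j V(1) by (intro mult_left_mono Max_ge) auto
    finally show "x \<le> k n * (MAX j\<in>V n. measure_pmf.prob (\<nu> n) {U. j \<in> U})" .
  qed (use V in auto)
  ultimately show "?m \<longlonglongrightarrow> 0"
    by (intro real_tendsto_sandwich[OF _ _ tendsto_const lim]) auto
qed

text \<open>For a point mass every clue is 0 by convention. One such index would violate the uniform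
  bound \<open>c\<close> yet be invisible to a limit; \<open>not_point_mass\<close> excludes
  this.\<close>

theorem corollary5p5:
  fixes \<Omega> :: "'a set" and V :: "nat \<Rightarrow> 'v set" and \<mu> :: "nat \<Rightarrow> ('v \<Rightarrow> 'a) measure"
  assumes spin_systems: "\<And>n. spin_system \<Omega> (V n) (\<mu> n)"
    and not_point_mass: "\<And>n \<omega>. measure (\<mu> n) {\<omega>} \<noteq> 1"
  shows "random_sparse_reconstruction \<Omega> V \<mu> \<longleftrightarrow>
    (\<exists>f :: nat \<Rightarrow> ('v \<Rightarrow> 'a) \<Rightarrow> real.
       (\<forall>n. f n \<in> (V n \<rightarrow>\<^sub>E \<Omega>) \<rightarrow> {-1, 1}) \<and>
       full_random_sparse_reconstruction \<Omega> V \<mu> f)"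
proof
  assume "random_sparse_reconstruction \<Omega> V \<mu>"
  then obtain f \<nu> c where sparse: "sparse_random_subsets V \<nu>" and c: "c > 0"
    "\<And>n. c < spin_system.expected_clue \<Omega> (\<mu> n) (f n) (\<nu> n)"
    unfolding random_sparse_reconstruction_def by blast
  have V: "finite (V n)" "V n \<noteq> {}" for n
    using spin_system.finite_sites[OF spin_systems] spin_system.sites_nonempty[OF spin_systems not_point_mass]
    by blast+
  define s where "s n = (MAX j\<in>V n. measure_pmf.prob (\<nu> n) {U. j \<in> U})" for n
  have supp: "set_pmf (\<nu> n) \<subseteq> Pow (V n)" and s: "s \<longlonglongrightarrow> 0" for n
    using sparse by (auto simp: sparse_random_subsets_def s_def[abs_def])
  have "s n \<ge> 0" for n
  proof -
    obtain j where "j \<in> V n" using V(2) by blast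
    then show ?thesis
      unfolding s_def using V(1) by (intro order_trans[OF measure_nonneg Max_ge]) auto
  qed
  from vanishing_multiplier[OF s this] obtain k :: "nat \<Rightarrow> nat" where k: "\<And>n. k n > 0" "(\<lambda>n. 1 / k n) \<longlonglongrightarrow> 0" "(\<lambda>n. k n * s n) \<longlonglongrightarrow> 0"
    by blast
  define \<rho> where "\<rho> n = map_pmf (\<lambda>L. \<Union>(set L)) (replicate_pmf (k n) (\<nu> n))" for n
  have "\<exists>B. (\<forall>\<omega>. B \<omega> \<in> {-1, 1 :: real}) \<and>
      spin_system.expected_clue \<Omega> (\<mu> n) B (\<rho> n) \<ge> 1 - 8 / sqrt (k n * c)" for n
    unfolding \<rho>_def using spin_system.boolean_amplification[OF spin_systems supp c k(1)] .
  then obtain B where B: "\<And>n \<omega>. B n \<omega> \<in> {-1, 1 :: real}"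
    "\<And>n. spin_system.expected_clue \<Omega> (\<mu> n) (B n) (\<rho> n) \<ge> 1 - 8 / sqrt (k n * c)"
    by metis
  have "sparse_random_subsets V \<rho>"
    unfolding \<rho>_def[abs_def] using V supp k(3)[unfolded s_def] by (rule sparse_random_subsets_union)
  moreover have "(\<lambda>n. spin_system.expected_clue \<Omega> (\<mu> n) (B n) (\<rho> n)) \<longlonglongrightarrow> 1"
  proof (rule real_tendsto_sandwich)
    have "(\<lambda>n. 1 - 8 * sqrt (1 / k n * (1 / c))) \<longlonglongrightarrow> 1 - 8 * sqrt (0 * (1 / c))"
      by (intro tendsto_intros k)
    moreover have "8 * sqrt (1 / k n * (1 / c)) = 8 / sqrt (k n * c)" for n
      by (simp add: real_sqrt_divide real_sqrt_mult)
    ultimately show "(\<lambda>n. 1 - 8 / sqrt (k n * c)) \<longlonglongrightarrow> 1" by simp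
  next
    have "spin_system.expected_clue \<Omega> (\<mu> n) (B n) (\<rho> n) \<le> 1" for n
      by (rule spin_system.expected_clue_le_1[OF spin_systems])
    then show "\<forall>\<^sub>F n in sequentially. spin_system.expected_clue \<Omega> (\<mu> n) (B n) (\<rho> n) \<le> 1"
      by simp
  qed (use B in auto)
  ultimately show "\<exists>f. (\<forall>n. f n \<in> (V n \<rightarrow>\<^sub>E \<Omega>) \<rightarrow> {-1, 1}) \<and> full_random_sparse_reconstruction \<Omega> V \<mu> f"
    unfolding full_random_sparse_reconstruction_def using B(1) by (intro exI[of _ B]) blast
next
  assume "\<exists>f. (\<forall>n. f n \<in> (V n \<rightarrow>\<^sub>E \<Omega>) \<rightarrow> {-1, 1}) \<and> full_random_sparse_reconstruction \<Omega> V \<mu> f"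
  then obtain f \<nu> where sparse: "sparse_random_subsets V \<nu>"
    and lim: "(\<lambda>n. spin_system.expected_clue \<Omega> (\<mu> n) (f n) (\<nu> n)) \<longlonglongrightarrow> 1"
    unfolding full_random_sparse_reconstruction_def by blast
  define good where "good n \<longleftrightarrow> spin_system.expected_clue \<Omega> (\<mu> n) (f n) (\<nu> n) > 1 / 2" for n
  have good: "\<forall>\<^sub>F n in sequentially. good n"
    unfolding good_def using lim by (rule order_tendstoD) simp
  have "\<exists>B. spin_system.clue \<Omega> (\<mu> n) B (V n) = 1" for n
    using spin_system.boolean_clue_sites_eq_1[OF spin_systems not_point_mass] by blast
  then obtain B where B: "\<And>n. spin_system.clue \<Omega> (\<mu> n) (B n) (V n) = 1"
    by metis
  \<comment> \<open>The limit gives the bound 1/2 only eventually. At the remaining finitely many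
    indices all sites are revealed, which gives clue 1 without affecting asymptotic
    sparsity.\<close>
  define \<nu>' where "\<nu>' n = (if good n then \<nu> n else return_pmf (V n))" for n
  define f' where "f' n = (if good n then f n else B n)" for n
  have "sparse_random_subsets V \<nu>'"
  proof (rule sparse_random_subsets_change_finite[OF sparse])
    show "set_pmf (\<nu>' n) \<subseteq> Pow (V n)" for n
      using sparse by (auto simp: \<nu>'_def sparse_random_subsets_def)
    show "\<forall>\<^sub>F n in sequentially. \<nu>' n = \<nu> n"
      using good by eventually_elim (simp add: \<nu>'_def)
  qed
  moreover have "spin_system.expected_clue \<Omega> (\<mu> n) (f' n) (\<nu>' n) > 1 / 2" for n
    using B[of n] by (auto simp: f'_def \<nu>'_def good_def spin_system.expected_clue_def[OF spin_systems])
  ultimately show "random_sparse_reconstruction \<Omega> V \<mu>"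
    unfolding random_sparse_reconstruction_def by (intro exI[of _ f'] exI[of _ \<nu>'] exI[of _ "1 / 2"]) auto
qed

end
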